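(* Let $G$ be a finite simple undirected graph. Let $\omega(G)$ denote the maximum number of vertices in a clique of $G$ and $\omega'(G):=\binom{\omega(G)}{2}$ the number of edges of a maximum clique of $G$. Then every clique partition $\mathcal{X}$ of $G$ that can be returned by the algorithm \textsc{Greedy Edmonds} (for any choices of maximum cliques and maximum matchings made during its execution) satisfies \[ \mathsf{OPT} \leq \frac{2\omega'(G)}{\omega'(G)+1}\,|E(\mathcal{X})|, \] where $\mathsf{OPT}$ is the maximum of $|E(\mathcal{Y})|$ over all clique partitions $\mathcal{Y}$ of $G$.
   Context: A clique of a graph is a set of pairwise adjacent vertices. A clique partition of $G$ is a partition of $V(G)$ into cliques of $G$; for a clique partition $\mathcal{X}$, $E(\mathcal{X})$ denotes the set of edges of $G$ with both ends in the same part of $\mathcal{X}$. The algorithm \textsc{Greedy Edmonds} on input $G$ is: set $\mathcal{X}=\emptyset$; while $G$ has at least one vertex: if $\omega(G)=2$, compute a maximum matching $\mathcal{M}$ of $G$, add each edge of $\mathcal{M}$ (as a 2-vertex clique) to $\mathcal{X}$, and replace $G$ by $G-V(\mathcal{M})$; otherwise, compute a maximum clique $X$ of $G$ (a clique of size $\omega(G)$), add $X$ to $\mathcal{X}$, and replace $G$ by $G-X$. Output $\mathcal{X}$. *)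

theory Defs
  imports Complex_Main "HOL-Library.Disjoint_Sets"
begin

text \<open>A finite simple undirected graph is given by its vertex set \<open>V\<close> and its set \<open>E\<close> of
  two-element edges.\<close>

definition finite_simple_graph :: "'a set \<Rightarrow> 'a set set \<Rightarrow> bool" where
  "finite_simple_graph V E \<longleftrightarrow> finite V \<and> (\<forall>e\<in>E. e \<subseteq> V \<and> card e = 2)"

definition induced_edges :: "'a set set \<Rightarrow> 'a set \<Rightarrow> 'a set set" where
  "induced_edges E U = {e \<in> E. e \<subseteq> U}"

definition clique :: "'a set \<Rightarrow> 'a set set \<Rightarrow> 'a set \<Rightarrow> bool" where
  "clique V E K \<longleftrightarrow> K \<subseteq> V \<and> (\<forall>u\<in>K. \<forall>v\<in>K. u \<noteq> v \<longrightarrow> {u, v} \<in> E)"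

text \<open>The empty set is a clique, so the maximum is over a nonempty set and the empty graph has
  clique number 0.\<close>

definition clique_number :: "'a set \<Rightarrow> 'a set set \<Rightarrow> nat" where
  "clique_number V E = Max (card ` {K. clique V E K})"

definition clique_edge_number :: "'a set \<Rightarrow> 'a set set \<Rightarrow> nat" where
  "clique_edge_number V E = clique_number V E choose 2"

definition maximum_clique :: "'a set \<Rightarrow> 'a set set \<Rightarrow> 'a set \<Rightarrow> bool" where
  "maximum_clique V E K \<longleftrightarrow> clique V E K \<and> card K = clique_number V E"

definition matching :: "'a set set \<Rightarrow> 'a set set \<Rightarrow> bool" where
  "matching E M \<longleftrightarrow> M \<subseteq> E \<and> disjoint M"

definition maximum_matching :: "'a set set \<Rightarrow> 'a set set \<Rightarrow> bool" where
  "maximum_matching E M \<longleftrightarrow> matching E M \<and> (\<forall>M'. matching E M' \<longrightarrow> card M' \<le> card M)"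

definition clique_partition :: "'a set \<Rightarrow> 'a set set \<Rightarrow> 'a set set \<Rightarrow> bool" where
  "clique_partition V E \<X> \<longleftrightarrow> partition_on V \<X> \<and> (\<forall>K\<in>\<X>. clique V E K)"

definition edges_within :: "'a set set \<Rightarrow> 'a set set \<Rightarrow> 'a set set" where
  "edges_within E \<X> = {e \<in> E. \<exists>K\<in>\<X>. e \<subseteq> K}"

definition opt :: "'a set \<Rightarrow> 'a set set \<Rightarrow> nat" where
  "opt V E = Max ((\<lambda>\<Y>. card (edges_within E \<Y>)) ` {\<Y>. clique_partition V E \<Y>})"

text \<open>\<open>greedy_edmonds_loop V E \<X> \<Y>\<close>: the while loop, entered with current graph \<open>(V, E)\<close> and
  current collection \<open>\<X>\<close>, can end with output \<open>\<Y>\<close>. The choices of maximum cliques and maximum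
  matchings are nondeterministic. Edges are two-element vertex sets, so a matching is itself a set
  of two-vertex cliques.\<close>

inductive greedy_edmonds_loop ::
  "'a set \<Rightarrow> 'a set set \<Rightarrow> 'a set set \<Rightarrow> 'a set set \<Rightarrow> bool" where
  stop: "greedy_edmonds_loop {} E \<X> \<X>"
| matching_step:
    "\<lbrakk>V \<noteq> {}; clique_number V E = 2; maximum_matching E M;
      greedy_edmonds_loop (V - \<Union>M) (induced_edges E (V - \<Union>M)) (\<X> \<union> M) \<Y>\<rbrakk>
     \<Longrightarrow> greedy_edmonds_loop V E \<X> \<Y>"
| clique_step:
    "\<lbrakk>V \<noteq> {}; clique_number V E \<noteq> 2; maximum_clique V E K;
      greedy_edmonds_loop (V - K) (induced_edges E (V - K)) (insert K \<X>) \<Y>\<rbrakk>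
     \<Longrightarrow> greedy_edmonds_loop V E \<X> \<Y>"

definition greedy_edmonds :: "'a set \<Rightarrow> 'a set set \<Rightarrow> 'a set set \<Rightarrow> bool" where
  "greedy_edmonds V E \<X> \<longleftrightarrow> greedy_edmonds_loop V E {} \<X>"

end

theory Submission
  imports Defs
begin

text \<open>Give a part of size \<open>s\<close> of a clique partition the weight \<open>(s choose 2) + 1\<close> if \<open>s \<ge> 2\<close> and
  \<open>0\<close> otherwise. When Greedy Edmonds removes a maximum clique of size \<open>j \<noteq> 2\<close>, a part losing \<open>r\<close> of
  its vertices loses at most \<open>r (j - 1)\<close> of its weight, so the total weight drops by at most
  \<open>j (j - 1)\<close>, which is twice the number of edges gained. When \<open>\<omega> = 2\<close>, the total weight is twice
  the size of a matching. Hence the total weight of every clique partition is at most twice the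
  number of edges found by the algorithm. As every part has at most \<open>\<omega>'\<close> edges, its weight is at
  least \<open>(\<omega>' + 1) / \<omega>'\<close> times its number of edges.\<close>

section \<open>Arithmetic of part weights\<close>

definition weight :: "nat \<Rightarrow> nat" where
  "weight s = (if s < 2 then 0 else (s choose 2) + 1)"

lemma two_choose_two: "2 * (n choose 2) = n * (n - 1)"
  by (cases n) (auto simp: choose_two)

text \<open>Build a clique on \<open>t + r\<close> vertices from one on \<open>t\<close>: each of
  the \<open>r\<close> new vertices has at most \<open>t + r - 1\<close> neighbours.\<close>

lemma choose_two_add_le: "(t + r) choose 2 \<le> (t choose 2) + r * (t + r - 1)"
proof (induction r)
  case (Suc r)
  have "(t + Suc r) choose 2 = (t + r) + ((t + r) choose 2)"
    by (simp add: numeral_2_eq_2)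
  also have "\<dots> \<le> (t + r) + ((t choose 2) + r * (t + r))"
    using Suc.IH mult_le_mono2[of "t + r - 1" "t + r" r] by linarith
  finally show ?case by simp
qed simp

text \<open>Each removed vertex destroys at most \<open>j - 1\<close> edges; the extra 1 in the
  weight matters only if fewer than two vertices remain. For \<open>s = j = 2\<close> and
  \<open>r = 1\<close> the bound fails (2 against 1), which is why the algorithm turns to matchings
  there.\<close>

lemma weight_diff_le:
  assumes "s \<le> j" "j \<noteq> 2" "r \<le> s"
  shows "weight s \<le> weight (s - r) + r * (j - 1)"
proof -
  define t where "t = s - r"
  have s: "s = t + r" using assms by (simp add: t_def)
  consider "s < 2" | "t \<ge> 2" | "s = 2" "t < 2" | "s \<ge> 3" "t < 2" by linarith
  then have "weight s \<le> weight t + r * (j - 1)"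
  proof cases
    case 1
    then show ?thesis by (simp add: weight_def)
  next
    case 2
    have "r * (t + r - 1) \<le> r * (j - 1)"
      using assms(1) s by (intro mult_le_mono2 diff_le_mono) simp
    with choose_two_add_le[of t r] have "s choose 2 \<le> (t choose 2) + r * (j - 1)"
      unfolding s by linarith
    with 2 s show ?thesis by (simp add: weight_def)
  next
    case 3
    \<comment> \<open>Here \<open>2 = s \<le> j\<close> and \<open>j \<noteq> 2\<close> force
      \<open>j \<ge> 3\<close>, so one removed vertex already pays for the whole weight 2.\<close>
    then have "r \<ge> 1" "j - 1 \<ge> 2" using s assms by auto
    then have "1 * 2 \<le> r * (j - 1)" by (intro mult_le_mono)
    with 3 show ?thesis by (simp add: weight_def)
  next
    case 4
    then obtain u where u: "s = u + 3" by (metis add.commute le_Suc_ex)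
    \<comment> \<open>True from \<open>s = 3\<close> on, with equality at 3. At most one vertex is
      left, so \<open>r \<ge> s - 1\<close>.\<close>
    have "2 * ((s choose 2) + 1) \<le> 2 * ((s - 1) * (s - 1))"
      using two_choose_two[of s] by (simp add: u algebra_simps)
    moreover have "(s - 1) * (s - 1) \<le> r * (j - 1)"
      using 4 s assms by (intro mult_le_mono) auto
    ultimately show ?thesis using 4 by (simp add: weight_def)
  qed
  then show ?thesis by (simp add: t_def)
qed

lemma weight_ge:
  assumes "s choose 2 \<le> m"
  shows "(m + 1) * (s choose 2) \<le> m * weight s"
proof (cases "s < 2")
  case False
  then show ?thesis using assms by (simp add: weight_def algebra_simps)
qed (simp add: weight_def)

section \<open>Finite graphs, cliques and their edges\<close>

lemma finite_simple_graph_finite_edges: "finite_simple_graph V E \<Longrightarrow> finite E"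
  unfolding finite_simple_graph_def by (rule finite_subset[of _ "Pow V"]) auto

lemma finite_simple_graph_induced:
  "finite_simple_graph V E \<Longrightarrow> finite_simple_graph (V - K) (induced_edges E (V - K))"
  by (auto simp: finite_simple_graph_def induced_edges_def)

lemma finite_cliques: "finite V \<Longrightarrow> finite {K. clique V E K}"
  by (rule finite_subset[of _ "Pow V"]) (auto simp: clique_def)

lemma card_clique_le: "finite V \<Longrightarrow> clique V E K \<Longrightarrow> card K \<le> clique_number V E"
  unfolding clique_number_def by (intro Max_ge finite_imageI finite_cliques) auto

lemma clique_Diff: "clique V E C \<Longrightarrow> clique (V - K) (induced_edges E (V - K)) (C - K)"
  unfolding clique_def induced_edges_def by blast

lemma card_edges_in_clique:
  assumes "finite_simple_graph V E" "clique V E K"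
  shows "card {e \<in> E. e \<subseteq> K} = card K choose 2"
proof -
  have "finite K" using assms by (auto simp: finite_simple_graph_def clique_def intro: finite_subset)
  moreover have "{e \<in> E. e \<subseteq> K} = {e. e \<subseteq> K \<and> card e = 2}"
    using assms by (auto simp: finite_simple_graph_def clique_def card_2_iff)
  ultimately show ?thesis by (simp add: n_subsets)
qed

section \<open>Weight bounds for one round and for the whole loop\<close>

lemma sum_card_Int_le:
  assumes "finite I" "finite K" "disjoint_family_on F I"
  shows "(\<Sum>i\<in>I. card (F i \<inter> K)) \<le> card K"
proof -
  have "(\<Sum>i\<in>I. card (F i \<inter> K)) = card (\<Union>i\<in>I. F i \<inter> K)"
    using assms by (intro card_UN_disjoint[symmetric]) (auto simp: disjoint_family_on_def)
  also have "\<dots> \<le> card K" using assms by (intro card_mono) auto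
  finally show ?thesis .
qed

text \<open>All members have at most two vertices, so each weighs 2 or 0, and those of weight 2 are
  edges forming a matching.\<close>

lemma sum_weight_le_maximum_matching:
  assumes G: "finite_simple_graph V E" and \<omega>: "clique_number V E = 2"
    and M: "maximum_matching E M"
    and I: "finite I" "disjoint_family_on F I" "\<forall>i\<in>I. clique V E (F i)"
  shows "(\<Sum>i\<in>I. weight (card (F i))) \<le> 2 * card M"
proof -
  define J where "J = {i \<in> I. card (F i) = 2}"
  have le: "card (F i) \<le> 2" if "i \<in> I" for i
    using card_clique_le[of V E "F i"] G \<omega> I that by (auto simp: finite_simple_graph_def)
  have "(\<Sum>i\<in>I. weight (card (F i))) = (\<Sum>i\<in>I. if card (F i) = 2 then 2 else 0)"
    by (rule sum.cong) (auto simp: weight_def dest: le)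
  also have "\<dots> = 2 * card J"
    using I by (simp add: J_def sum.If_cases Int_def)
  \<comment> \<open>A disjoint family may repeat the empty set, but not a two-element set.\<close>
  also have "card J = card (F ` J)"
  proof (rule card_image[symmetric], rule inj_onI)
    fix x y assume *: "x \<in> J" "y \<in> J" "F x = F y"
    then have "F x \<inter> F y \<noteq> {}" by (auto simp: J_def card_2_iff)
    then show "x = y" using * I by (auto simp: J_def disjoint_family_on_def)
  qed
  also have "card (F ` J) \<le> card M"
  proof -
    have "F i \<in> E" if "i \<in> J" for i
    proof -
      have "card (F i) = 2" using that by (simp add: J_def)
      then obtain u v where "F i = {u, v}" "u \<noteq> v" by (meson card_2_iff)
      then show ?thesis using I(3) that by (auto simp: J_def clique_def)
    qed
    moreover have "disjoint (F ` J)"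
    proof (rule disjointI)
      fix A B assume "A \<in> F ` J" "B \<in> F ` J" "A \<noteq> B"
      then obtain x y where "x \<in> I" "y \<in> I" "x \<noteq> y" "A = F x" "B = F y"
        by (auto simp: J_def)
      then show "A \<inter> B = {}" using I(2) by (simp add: disjoint_family_on_def)
    qed
    ultimately have "matching E (F ` J)" by (auto simp: matching_def)
    with M show ?thesis by (simp add: maximum_matching_def)
  qed
  finally show ?thesis by simp
qed

text \<open>Every vertex of \<open>K\<close> lies in at most one member and is charged
  \<open>card K - 1\<close>, which makes at most twice the number of edges of \<open>K\<close> in
  total.\<close>

lemma sum_weight_Diff_le:
  assumes V: "finite V" and \<omega>: "clique_number V E \<noteq> 2" and K: "maximum_clique V E K"
    and I: "finite I" "disjoint_family_on F I" "\<forall>i\<in>I. clique V E (F i)"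
  shows "(\<Sum>i\<in>I. weight (card (F i))) \<le>
    (\<Sum>i\<in>I. weight (card (F i - K))) + 2 * (card K choose 2)"
proof -
  have finK: "finite K" and j: "card K \<noteq> 2"
    using V \<omega> K by (auto simp: maximum_clique_def clique_def intro: finite_subset)
  have "weight (card (F i)) \<le> weight (card (F i - K)) + card (F i \<inter> K) * (card K - 1)"
    if "i \<in> I" for i
  proof -
    have C: "clique V E (F i)" and fin: "finite (F i)"
      using I V that by (auto simp: clique_def intro: finite_subset)
    have "card (F i) \<le> card K" using card_clique_le[OF V C] K by (simp add: maximum_clique_def)
    moreover have "card (F i - K) = card (F i) - card (F i \<inter> K)"
      using fin by (simp add: card_Diff_subset_Int)
    moreover have "card (F i \<inter> K) \<le> card (F i)" using fin by (simp add: card_mono)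
    ultimately show ?thesis using weight_diff_le j by metis
  qed
  then have "(\<Sum>i\<in>I. weight (card (F i))) \<le>
      (\<Sum>i\<in>I. weight (card (F i - K))) + (\<Sum>i\<in>I. card (F i \<inter> K)) * (card K - 1)"
    by (simp add: sum_mono sum_distrib_right flip: sum.distrib)
  also have "\<dots> \<le> (\<Sum>i\<in>I. weight (card (F i - K))) + card K * (card K - 1)"
    using sum_card_Int_le[OF I(1) finK I(2)] by simp
  finally show ?thesis by (simp add: two_choose_two)
qed

text \<open>Only an inequality, since \<open>\<W>\<close> is arbitrary: its members may meet
  \<open>K\<close> and contain further edges.\<close>

lemma card_edges_within_insert:
  assumes G: "finite_simple_graph V E" and K: "clique V E K"
  shows "(card K choose 2) + card (edges_within (induced_edges E (V - K)) \<W>)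
    \<le> card (edges_within E (insert K \<W>))"
proof -
  let ?A = "{e \<in> E. e \<subseteq> K}" and ?B = "edges_within (induced_edges E (V - K)) \<W>"
  have fin: "finite E" using G by (rule finite_simple_graph_finite_edges)
  have "{} \<notin> E" using G by (auto simp: finite_simple_graph_def)
  moreover have "e = {}" if "e \<in> ?A" "e \<in> ?B" for e
    using that by (auto simp: edges_within_def induced_edges_def)
  ultimately have "?A \<inter> ?B = {}" by auto
  have "finite ?A" "finite ?B"
    using fin by (auto simp: edges_within_def induced_edges_def)
  with \<open>?A \<inter> ?B = {}\<close> have "(card K choose 2) + card ?B = card (?A \<union> ?B)"
    using card_edges_in_clique[OF G K] by (simp add: card_Un_disjoint)
  also have "\<dots> \<le> card (edges_within E (insert K \<W>))"
    using fin by (intro card_mono) (auto simp: edges_within_def induced_edges_def)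
  finally show ?thesis .
qed

text \<open>Clique families are indexed because deleting vertices can make several members empty.\<close>

lemma greedy_edmonds_loop_weight:
  assumes "greedy_edmonds_loop V E \<X> \<Z>" "finite_simple_graph V E"
  shows "\<exists>\<W>. \<Z> = \<X> \<union> \<W> \<and>
    (\<forall>F (I :: 'i set). finite I \<longrightarrow> disjoint_family_on F I \<longrightarrow> (\<forall>i\<in>I. clique V E (F i)) \<longrightarrow>
      (\<Sum>i\<in>I. weight (card (F i))) \<le> 2 * card (edges_within E \<W>))"
  using assms
proof (induction rule: greedy_edmonds_loop.induct)
  case (stop E \<X>)
  then show ?case by (intro exI[of _ "{}"]) (auto simp: clique_def weight_def)
next
  case (matching_step V E M \<X> \<Y>)
  then obtain \<W> where \<W>: "\<Y> = \<X> \<union> M \<union> \<W>"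
    using finite_simple_graph_induced by blast
  \<comment> \<open>The edges of \<open>M\<close> alone pay for the whole weight, so nothing is
    asked of the later rounds.\<close>
  have "M \<subseteq> edges_within E (M \<union> \<W>)"
    using matching_step.hyps by (auto simp: maximum_matching_def matching_def edges_within_def)
  moreover have "finite (edges_within E (M \<union> \<W>))"
    using finite_simple_graph_finite_edges[OF matching_step.prems] by (simp add: edges_within_def)
  ultimately have "card M \<le> card (edges_within E (M \<union> \<W>))" by (intro card_mono)
  then have "(\<Sum>i\<in>I. weight (card (F i))) \<le> 2 * card (edges_within E (M \<union> \<W>))"
    if "finite I" "disjoint_family_on F I" "\<forall>i\<in>I. clique V E (F i)" for F and I :: "'i set"
    using sum_weight_le_maximum_matching[OF matching_step.prems matching_step.hyps(2,3) that]
    by linarith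
  with \<W> show ?case by (intro exI[of _ "M \<union> \<W>"]) auto
next
  case (clique_step V E K \<X> \<Y>)
  have V: "finite V" and K: "clique V E K"
    using clique_step by (auto simp: finite_simple_graph_def maximum_clique_def)
  obtain \<W> where \<W>: "\<Y> = insert K \<X> \<union> \<W>"
    and IH: "\<And>F (I :: 'i set). finite I \<Longrightarrow> disjoint_family_on F I \<Longrightarrow>
      (\<forall>i\<in>I. clique (V - K) (induced_edges E (V - K)) (F i)) \<Longrightarrow>
      (\<Sum>i\<in>I. weight (card (F i))) \<le> 2 * card (edges_within (induced_edges E (V - K)) \<W>)"
    using clique_step.IH[OF finite_simple_graph_induced[OF clique_step.prems]] by blast
  have "(\<Sum>i\<in>I. weight (card (F i))) \<le> 2 * card (edges_within E (insert K \<W>))"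
    if I: "finite I" "disjoint_family_on F I" "\<forall>i\<in>I. clique V E (F i)" for F and I :: "'i set"
  proof -
    \<comment> \<open>The sets \<open>F i - K\<close>, over the same indices, are disjoint cliques
      of the remaining graph.\<close>
    have "(\<Sum>i\<in>I. weight (card (F i - K))) \<le>
        2 * card (edges_within (induced_edges E (V - K)) \<W>)"
      using I by (intro IH) (auto simp: clique_Diff disjoint_family_on_def)
    then show ?thesis
      using sum_weight_Diff_le[OF V clique_step.hyps(2,3) I]
        card_edges_within_insert[OF clique_step.prems K, of \<W>]
      by linarith
  qed
  with \<W> show ?case by (intro exI[of _ "insert K \<W>"]) auto
qed

section \<open>Comparison with an optimal clique partition\<close>

lemma clique_partition_greedy_edmonds_le:
  assumes G: "finite_simple_graph V E" and "greedy_edmonds V E \<X>" and P: "clique_partition V E \<Y>"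
  defines "m \<equiv> clique_edge_number V E"
  shows "(m + 1) * card (edges_within E \<Y>) \<le> 2 * m * card (edges_within E \<X>)"
proof -
  have V: "finite V" using G by (simp add: finite_simple_graph_def)
  have cl: "clique V E C" if "C \<in> \<Y>" for C using P that by (simp add: clique_partition_def)
  have part: "partition_on V \<Y>" using P by (simp add: clique_partition_def)
  have fin: "finite \<Y>" using finite_elements[OF V part] .
  have "edges_within E \<Y> = (\<Union>C\<in>\<Y>. {e \<in> E. e \<subseteq> C})" by (auto simp: edges_within_def)
  then have "card (edges_within E \<Y>) \<le> (\<Sum>C\<in>\<Y>. card {e \<in> E. e \<subseteq> C})"
    using card_UN_le[OF fin] by metis
  also have "\<dots> = (\<Sum>C\<in>\<Y>. card C choose 2)"
    by (rule sum.cong) (auto simp: card_edges_in_clique[OF G] cl)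
  finally have "(m + 1) * card (edges_within E \<Y>) \<le> (\<Sum>C\<in>\<Y>. (m + 1) * (card C choose 2))"
    by (metis mult_le_mono2 sum_distrib_left)
  also have "\<dots> \<le> (\<Sum>C\<in>\<Y>. m * weight (card C))"
  proof (intro sum_mono weight_ge)
    fix C assume "C \<in> \<Y>"
    then show "card C choose 2 \<le> m"
      unfolding m_def clique_edge_number_def
      by (intro binomial_right_mono card_clique_le V cl)
  qed
  also have "\<dots> = m * (\<Sum>C\<in>\<Y>. weight (card C))" by (simp add: sum_distrib_left)
  also have "(\<Sum>C\<in>\<Y>. weight (card C)) \<le> 2 * card (edges_within E \<X>)"
  proof -
    \<comment> \<open>The partition is indexed by its own parts. The loop starts from
      \<open>{}\<close>, so the \<open>\<W>\<close> of the weight bound is \<open>\<X>\<close>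
      itself.\<close>
    have "disjoint_family_on (\<lambda>C. C) \<Y>"
      using part by (auto simp: partition_on_def disjoint_def disjoint_family_on_def)
    then show ?thesis
      using greedy_edmonds_loop_weight[where ?'i = "'a set", of V E "{}" \<X>] assms(2) G fin cl
      unfolding greedy_edmonds_def by auto
  qed
  finally show ?thesis by (simp add: mult.assoc mult.left_commute)
qed

lemma opt_attained:
  assumes "finite V"
  shows "\<exists>\<Y>. clique_partition V E \<Y> \<and> opt V E = card (edges_within E \<Y>)"
proof -
  let ?S = "{\<Y>. clique_partition V E \<Y>}"
  have "?S \<subseteq> Pow (Pow V)" by (auto simp: clique_partition_def partition_on_def)
  then have "finite ?S" using assms by (simp add: finite_subset)
  \<comment> \<open>The partition into singletons shows that the maximum is over a nonempty
    set.\<close>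
  moreover have "(\<lambda>v. {v}) ` V \<in> ?S"
    by (auto simp: clique_partition_def partition_on_def clique_def disjoint_def)
  ultimately have "opt V E \<in> (\<lambda>\<Y>. card (edges_within E \<Y>)) ` ?S"
    unfolding opt_def by (intro Max_in) auto
  then show ?thesis by auto
qed

theorem theorem2:
  fixes V :: "'a set" and E :: "'a set set" and \<X> :: "'a set set"
  assumes "finite_simple_graph V E"
    and "greedy_edmonds V E \<X>"
  shows "real (opt V E) \<le>
    2 * real (clique_edge_number V E) / (real (clique_edge_number V E) + 1)
      * real (card (edges_within E \<X>))"
proof -
  let ?m = "clique_edge_number V E"
  have "finite V" using assms by (simp add: finite_simple_graph_def)
  then obtain \<Y> where "clique_partition V E \<Y>" and opt: "opt V E = card (edges_within E \<Y>)"
    using opt_attained by blast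
  then have "(?m + 1) * opt V E \<le> 2 * ?m * card (edges_within E \<X>)"
    using clique_partition_greedy_edmonds_le[OF assms] by simp
  then have "real ((?m + 1) * opt V E) \<le> real (2 * ?m * card (edges_within E \<X>))"
    by (rule of_nat_mono)
  then have "(real ?m + 1) * real (opt V E) \<le> 2 * real ?m * real (card (edges_within E \<X>))"
    by (simp only: of_nat_mult of_nat_add of_nat_1 of_nat_numeral)
  moreover have "0 < real ?m + 1" by simp
  ultimately show ?thesis
    unfolding times_divide_eq_left by (simp only: pos_le_divide_eq mult.commute)
qed

end
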